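(* Let $S$ be a set of separations of a finite set $V$, and let $\sigma$ be an orientation of $S$. For $v\in V$ let $$C_\sigma(v)=\{\{A,B\}\in S\mid (A,B)\in\sigma,\ v\in A\},\qquad D_\sigma(v)=\{\{A,B\}\in S\mid (A,B)\in\sigma,\ v\in B\}.$$ Then the following two assertions are equivalent: (i) There exists a function $w\colon V\to\mathbb{R}_{\ge0}$ on $V$ that induces $\sigma$. (ii) For every non-zero weight function $w'$ on $S$, there exists $v\in V$ such that $w'(C_\sigma(v))<w'(D_\sigma(v))$. In particular, if the map $\varphi_\sigma$ is injective and $\tau_\sigma$ is the default orientation of the dual set $V_\sigma$ of separations of $S$ with respect to $\sigma$, then $\sigma$ is induced by a function on $V$ if and only if every non-zero weight function $w'$ on $S$ induces a separation in $\tau_\sigma$.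
   Context: A separation of a finite set $V$ is an unordered pair $\{A,B\}$ of subsets of $V$ with $A\cup B=V$. Its two orientations are the ordered pairs $(A,B)$ and $(B,A)$. An orientation of a set $S$ of (unoriented) separations of $V$ is a set $\sigma$ consisting of exactly one orientation of each $s\in S$ (and nothing else). A weight function on a finite set $Y$ is a map $w\colon Y\to\mathbb{R}_{\ge0}$; it is non-zero if $w(y)>0$ for some $y\in Y$. For $Z\subseteq Y$ write $w(Z)=\sum_{z\in Z}w(z)$. A weight function $w$ on $Y$ induces an oriented separation $(A,B)$ of $Y$ if $w(A)<w(B)$; it induces an orientation of a set of separations of $Y$ if it induces all its elements. For every $v\in V$ the sets $C_\sigma(v)$ and $D_\sigma(v)$ are the sides of a separation $\varphi_\sigma(v):=\{C_\sigma(v),D_\sigma(v)\}$ of the set $S$; this defines a map $\varphi_\sigma$ from $V$ to the set of all separations of $S$. The dual set of separations of $S$ with respect to $\sigma$ is $V_\sigma:=\varphi_\sigma(V)$. If $\varphi_\sigma$ is injective, the default orientation $\tau_\sigma$ of $V_\sigma$ orients each $\varphi_\sigma(v)$ as $(C_\sigma(v),D_\sigma(v))$, i.e. $\tau_\sigma=\{(C_\sigma(v),D_\sigma(v))\mid v\in V\}$. *)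

theory Defs
  imports Complex_Main
begin

text \<open>
  The unordered pair \<open>{A, B}\<close> is encoded as a set of sets, so the degenerate separation
  \<open>{V, V}\<close> is allowed; it is the singleton \<open>{V}\<close> and its two orientations coincide.
\<close>

definition separation :: "'a set \<Rightarrow> 'a set set \<Rightarrow> bool" where
  "separation V s \<longleftrightarrow> (\<exists>A B. s = {A, B} \<and> A \<subseteq> V \<and> B \<subseteq> V \<and> A \<union> B = V)"

definition orientations :: "'a set set \<Rightarrow> ('a set \<times> 'a set) set" where
  "orientations s = {(A, B). {A, B} = s}"

definition orientation :: "'a set set set \<Rightarrow> ('a set \<times> 'a set) set \<Rightarrow> bool" where
  "orientation S \<sigma> \<longleftrightarrow>
     \<sigma> \<subseteq> (\<Union>s\<in>S. orientations s) \<and> (\<forall>s\<in>S. \<exists>!p. p \<in> \<sigma> \<and> p \<in> orientations s)"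

text \<open>
  A weight function on \<open>Y\<close> is a total function of which only the values on \<open>Y\<close> matter.
\<close>

definition weight_function :: "'b set \<Rightarrow> ('b \<Rightarrow> real) \<Rightarrow> bool" where
  "weight_function Y w \<longleftrightarrow> (\<forall>y\<in>Y. w y \<ge> 0)"

definition nonzero_weight_function :: "'b set \<Rightarrow> ('b \<Rightarrow> real) \<Rightarrow> bool" where
  "nonzero_weight_function Y w \<longleftrightarrow> weight_function Y w \<and> (\<exists>y\<in>Y. w y > 0)"

definition induces :: "('b \<Rightarrow> real) \<Rightarrow> 'b set \<times> 'b set \<Rightarrow> bool" where
  "induces w p \<longleftrightarrow> sum w (fst p) < sum w (snd p)"

definition induces_orientation :: "('b \<Rightarrow> real) \<Rightarrow> ('b set \<times> 'b set) set \<Rightarrow> bool" where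
  "induces_orientation w \<sigma> \<longleftrightarrow> (\<forall>p\<in>\<sigma>. induces w p)"

definition C_side :: "'a set set set \<Rightarrow> ('a set \<times> 'a set) set \<Rightarrow> 'a \<Rightarrow> 'a set set set" where
  "C_side S \<sigma> v = {{A, B} |A B. {A, B} \<in> S \<and> (A, B) \<in> \<sigma> \<and> v \<in> A}"

definition D_side :: "'a set set set \<Rightarrow> ('a set \<times> 'a set) set \<Rightarrow> 'a \<Rightarrow> 'a set set set" where
  "D_side S \<sigma> v = {{A, B} |A B. {A, B} \<in> S \<and> (A, B) \<in> \<sigma> \<and> v \<in> B}"

definition dual_separation ::
  "'a set set set \<Rightarrow> ('a set \<times> 'a set) set \<Rightarrow> 'a \<Rightarrow> 'a set set set set" where
  "dual_separation S \<sigma> v = {C_side S \<sigma> v, D_side S \<sigma> v}"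

definition dual_set ::
  "'a set \<Rightarrow> 'a set set set \<Rightarrow> ('a set \<times> 'a set) set \<Rightarrow> 'a set set set set set" where
  "dual_set V S \<sigma> = dual_separation S \<sigma> ` V"

definition default_orientation ::
  "'a set \<Rightarrow> 'a set set set \<Rightarrow> ('a set \<times> 'a set) set \<Rightarrow> ('a set set set \<times> 'a set set set) set" where
  "default_orientation V S \<sigma> = {(C_side S \<sigma> v, D_side S \<sigma> v) |v. v \<in> V}"

lemma separation_dual_separation:
  assumes "\<forall>s\<in>S. separation V s" and "orientation S \<sigma>" and "v \<in> V"
  shows "separation S (dual_separation S \<sigma> v)"
proof -
  have sub: "C_side S \<sigma> v \<subseteq> S" "D_side S \<sigma> v \<subseteq> S"
    unfolding C_side_def D_side_def by blast+
  have "s \<in> C_side S \<sigma> v \<union> D_side S \<sigma> v" if "s \<in> S" for s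
  proof -
    have "\<exists>!p. p \<in> \<sigma> \<and> p \<in> orientations s"
      using assms(2) that by (simp add: orientation_def)
    then obtain p where "p \<in> \<sigma>" "p \<in> orientations s"
      by (elim ex1E conjE)
    then obtain A B where AB: "(A, B) \<in> \<sigma>" "{A, B} = s"
      by (cases p) (simp add: orientations_def)
    have "separation V s"
      using assms(1) that by (rule bspec)
    then obtain A' B' where "s = {A', B'}" "A' \<union> B' = V"
      unfolding separation_def by (elim exE conjE)
    then have "A \<union> B = V"
      using AB(2) by (metis Un_commute doubleton_eq_iff)
    then consider "v \<in> A" | "v \<in> B"
      using assms(3) by auto
    then show ?thesis
    proof cases
      case 1
      then have "s \<in> C_side S \<sigma> v"
        unfolding C_side_def mem_Collect_eq using AB that by metis
      then show ?thesis ..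
    next
      case 2
      then have "s \<in> D_side S \<sigma> v"
        unfolding D_side_def mem_Collect_eq using AB that by metis
      then show ?thesis ..
    qed
  qed
  with sub have "C_side S \<sigma> v \<union> D_side S \<sigma> v = S"
    by (meson Un_least subsetI subset_antisym)
  with sub show ?thesis
    unfolding separation_def dual_separation_def by metis
qed

lemma orientation_default_orientation:
  assumes "inj_on (dual_separation S \<sigma>) V"
  shows "orientation (dual_set V S \<sigma>) (default_orientation V S \<sigma>)"
  unfolding orientation_def
proof (intro conjI ballI)
  show "default_orientation V S \<sigma> \<subseteq> (\<Union>s\<in>dual_set V S \<sigma>. orientations s)"
    unfolding default_orientation_def dual_set_def dual_separation_def orientations_def by blast
next
  fix s assume "s \<in> dual_set V S \<sigma>"
  then obtain v where v: "v \<in> V" "s = dual_separation S \<sigma> v"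
    by (auto simp: dual_set_def)
  show "\<exists>!p. p \<in> default_orientation V S \<sigma> \<and> p \<in> orientations s"
  proof (rule ex1I)
    show "(C_side S \<sigma> v, D_side S \<sigma> v) \<in> default_orientation V S \<sigma> \<and>
          (C_side S \<sigma> v, D_side S \<sigma> v) \<in> orientations s"
      using v unfolding default_orientation_def dual_separation_def orientations_def by blast
  next
    fix p assume p: "p \<in> default_orientation V S \<sigma> \<and> p \<in> orientations s"
    then obtain u where u: "u \<in> V" "p = (C_side S \<sigma> u, D_side S \<sigma> u)"
      by (auto simp: default_orientation_def)
    then have "dual_separation S \<sigma> u = dual_separation S \<sigma> v"
      using p v(2) by (simp add: orientations_def dual_separation_def)
    then have "u = v" by (rule inj_onD [OF assms _ u(1) v(1)])
    then show "p = (C_side S \<sigma> v, D_side S \<sigma> v)" using u by simp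
  qed
qed

end

theory Submission imports Defs begin

text \<open>
  Orient every \<open>s \<in> S\<close> as \<open>(A\<^sub>s, B\<^sub>s)\<close> according to \<open>\<sigma>\<close> and let \<open>M\<close> be the matrix with a row
  for every \<open>s \<in> S\<close>, a column for every \<open>v \<in> V\<close>, and entries \<open>[v \<in> B\<^sub>s] - [v \<in> A\<^sub>s]\<close>. A
  weight function \<open>w\<close> on \<open>V\<close> induces \<open>\<sigma>\<close> iff every row of \<open>M\<close> has positive product with
  \<open>w\<close>. Read along the columns, the same entries describe the dual separations:
  \<open>w'(C\<^sub>\<sigma>(v)) < w'(D\<^sub>\<sigma>(v))\<close> says that the column of \<open>v\<close> has positive product with \<open>w'\<close>. The
  equivalence is therefore Ville's theorem of the alternative: some non-negative combination
  of the columns is positive everywhere iff no non-negative non-zero combination of the rows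
  is \<open>\<le> 0\<close> everywhere.

  The two alternatives exclude each other by evaluating the bilinear form of \<open>M\<close> in two ways.
  That one of them holds is proved by Fourier-Motzkin elimination, one column at a time
  (\<open>positive_functional_on_finite_subset_of_cone\<close>). The elimination replaces
  rows by positive combinations of rows. Keeping a convex cone around the current
  rows, instead of recording the coefficients, makes the induction go through with no
  bookkeeping: eliminating the column \<open>j\<close> shrinks the cone to its part where the coordinate
  \<open>j\<close> is \<open>\<le> 0\<close>.
\<close>

section \<open>Fourier-Motzkin elimination and Ville's theorem\<close>

lemma finite_sets_strictly_between:
  fixes L U :: "real set"
  assumes "finite L" "finite U" and "\<And>l u. l \<in> L \<Longrightarrow> u \<in> U \<Longrightarrow> l < u"
  shows "\<exists>t. (\<forall>l\<in>L. l < t) \<and> (\<forall>u\<in>U. t < u)"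
proof (cases "L = {} \<or> U = {}")
  case True
  show ?thesis
  proof (cases "L = {}")
    case L: True
    show ?thesis
    proof (cases "U = {}")
      case False
      obtain t where "t < Min U"
        using lt_ex by blast
      then show ?thesis
        using L False assms(2) by auto
    qed (use L in auto)
  next
    case False
    obtain t where "Max L < t"
      using gt_ex by blast
    then show ?thesis
      using True False assms(1) by auto
  qed
next
  case False
  then have "Max L < Min U"
    using assms by simp
  then obtain t where "Max L < t" "t < Min U"
    using dense by blast
  then show ?thesis
    using False assms(1,2) by auto
qed

text \<open>
  Induction on the set of coordinates. To eliminate the coordinate \<open>j\<close>, keep the rows with
  \<open>r j \<le> 0\<close>, and combine every row \<open>p\<close> with \<open>p j > 0\<close> and every row \<open>n\<close> with \<open>n j < 0\<close> into the
  row \<open>p j * n - n j * p\<close>, whose coordinate \<open>j\<close> vanishes. If \<open>w\<close> is positive on these new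
  rows, then the bounds that the old rows put on a value of \<open>w\<close> at \<open>j\<close> are compatible with
  each other and with non-negativity.
\<close>

lemma positive_functional_on_finite_subset_of_cone:
  fixes K :: "('j \<Rightarrow> real) set"
  assumes "finite J" "finite R" "R \<subseteq> K"
    and "\<And>r s. r \<in> K \<Longrightarrow> s \<in> K \<Longrightarrow> (\<lambda>j. r j + s j) \<in> K"
    and "\<And>c r. 0 < c \<Longrightarrow> r \<in> K \<Longrightarrow> (\<lambda>j. c * r j) \<in> K"
    and "\<And>r. r \<in> K \<Longrightarrow> \<exists>j\<in>J. 0 < r j"
  shows "\<exists>w. (\<forall>j\<in>J. 0 \<le> w j) \<and> (\<forall>r\<in>R. 0 < (\<Sum>j\<in>J. r j * w j))"
  using assms
proof (induction J arbitrary: R K rule: finite_induct)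
  case empty
  then have "R = {}"
    by blast
  then show ?case
    by simp
next
  case (insert j J)
  note add = insert.prems(3) and scale = insert.prems(4)
  define elim :: "('j \<Rightarrow> real) \<times> ('j \<Rightarrow> real) \<Rightarrow> 'j \<Rightarrow> real"
    where "elim = (\<lambda>(p, n) k. p j * n k + (- n j) * p k)"
  define P where "P = {r \<in> R. 0 < r j}"
  define N where "N = {r \<in> R. r j < 0}"
  define R' where "R' = {r \<in> R. r j \<le> 0} \<union> elim ` (P \<times> N)"
  define K' where "K' = {r \<in> K. r j \<le> 0}"
  have fin: "finite P" "finite N" "finite R'"
    using insert.prems(1) by (simp_all add: P_def N_def R'_def)
  have "elim (p, n) \<in> K'" if "p \<in> P" "n \<in> N" for p n
  proof -
    have "p \<in> K" "n \<in> K" "0 < p j" "0 < - n j"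
      using that insert.prems(2) by (auto simp: P_def N_def)
    then have "elim (p, n) \<in> K"
      unfolding elim_def case_prod_conv by (intro add scale)
    then show ?thesis
      by (simp add: K'_def elim_def)
  qed
  then have "R' \<subseteq> K'"
    using insert.prems(2) by (auto simp: R'_def K'_def)
  moreover have "\<exists>k\<in>J. 0 < r k" if "r \<in> K'" for r
    using that insert.prems(5)[of r] by (auto simp: K'_def)
  moreover have "(\<lambda>k. r k + s k) \<in> K'" if "r \<in> K'" "s \<in> K'" for r s
    using that add by (auto simp: K'_def)
  moreover have "(\<lambda>k. c * r k) \<in> K'" if "0 < c" "r \<in> K'" for c r
    using that scale by (auto simp: K'_def mult_nonneg_nonpos)
  ultimately obtain w where w: "\<forall>k\<in>J. 0 \<le> w k"
    and pos: "\<forall>r\<in>R'. 0 < (\<Sum>k\<in>J. r k * w k)"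
    using insert.IH[OF fin(3), of K'] by blast
  define val where "val = (\<lambda>r. \<Sum>k\<in>J. r k * w k)"
  have val_N: "0 < val n" "n j < 0" if "n \<in> N" for n
    using pos that by (auto simp: val_def N_def R'_def)
  \<comment> \<open>A value \<open>t\<close> at \<open>j\<close> makes \<open>r\<close> positive iff \<open>val r + r j * t > 0\<close>; so rows in \<open>P\<close> bound \<open>t\<close>
    from below, rows in \<open>N\<close> bound it from above, and both bounds are \<open>- val r / r j\<close>.\<close>
  have "- val p / p j < - val n / n j" if "p \<in> P" "n \<in> N" for p n
  proof -
    have "elim (p, n) \<in> R'"
      using that by (auto simp: R'_def)
    then have "0 < (\<Sum>k\<in>J. elim (p, n) k * w k)"
      using pos by blast
    also have "\<dots> = p j * val n + (- n j) * val p"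
      unfolding elim_def val_def sum_distrib_left sum.distrib[symmetric] case_prod_conv
      by (intro sum.cong) (simp_all add: algebra_simps)
    finally show ?thesis
      using that by (simp add: P_def N_def field_simps)
  qed
  moreover have "0 < - val n / n j" if "n \<in> N" for n
    using val_N[OF that] by (simp add: divide_less_0_iff)
  ultimately have "\<exists>t. (\<forall>l\<in>insert 0 ((\<lambda>p. - val p / p j) ` P). l < t) \<and>
      (\<forall>u\<in>(\<lambda>n. - val n / n j) ` N. t < u)"
    using fin by (intro finite_sets_strictly_between) auto
  then obtain t where t: "0 < t" "\<And>p. p \<in> P \<Longrightarrow> - val p / p j < t"
      "\<And>n. n \<in> N \<Longrightarrow> t < - val n / n j"
    by auto
  have "0 < val r + r j * t" if "r \<in> R" for r
  proof -
    consider "r \<in> P" | "r \<in> N" | "r j = 0"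
      using \<open>r \<in> R\<close> by (fastforce simp: P_def N_def)
    then show ?thesis
    proof cases
      case 1
      then show ?thesis
        using t(2)[OF 1] by (simp add: P_def field_simps)
    next
      case 2
      then show ?thesis
        using t(3)[OF 2] by (simp add: N_def field_simps)
    next
      case 3
      then show ?thesis
        using that pos by (simp add: R'_def val_def)
    qed
  qed
  moreover have "(\<Sum>k\<in>insert j J. r k * (w(j := t)) k) = val r + r j * t" for r
  proof -
    have "(\<Sum>k\<in>J. r k * (w(j := t)) k) = val r"
      unfolding val_def using insert.hyps(2) by (intro sum.cong) auto
    then show ?thesis
      using insert.hyps by simp
  qed
  ultimately show ?case
    using w t(1) by (intro exI[of _ "w(j := t)"]) auto
qed

text \<open>
  The existence part applies the previous lemma to the cone of all non-negative non-zero
  combinations of the rows.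
\<close>

theorem Ville_alternative:
  fixes M :: "'i \<Rightarrow> 'j \<Rightarrow> real"
  assumes "finite I" "finite J"
  shows "(\<exists>w. weight_function J w \<and> (\<forall>i\<in>I. 0 < (\<Sum>j\<in>J. M i j * w j))) \<longleftrightarrow>
    (\<forall>y. nonzero_weight_function I y \<longrightarrow> (\<exists>j\<in>J. 0 < (\<Sum>i\<in>I. y i * M i j)))"
proof (intro iffI allI impI)
  fix y
  assume "\<exists>w. weight_function J w \<and> (\<forall>i\<in>I. 0 < (\<Sum>j\<in>J. M i j * w j))"
    and y: "nonzero_weight_function I y"
  then obtain w where w: "weight_function J w" "\<forall>i\<in>I. 0 < (\<Sum>j\<in>J. M i j * w j)"
    by blast
  obtain i0 where i0: "i0 \<in> I" "0 < y i0"
    using y by (auto simp: nonzero_weight_function_def)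
  show "\<exists>j\<in>J. 0 < (\<Sum>i\<in>I. y i * M i j)"
  proof (rule ccontr)
    assume "\<not> ?thesis"
    then have "(\<Sum>j\<in>J. (\<Sum>i\<in>I. y i * M i j) * w j) \<le> 0"
      using w(1) by (intro sum_nonpos) (auto simp: weight_function_def mult_nonpos_nonneg)
    also have "(\<Sum>j\<in>J. (\<Sum>i\<in>I. y i * M i j) * w j) = (\<Sum>j\<in>J. \<Sum>i\<in>I. y i * (M i j * w j))"
      by (simp add: sum_distrib_right mult.assoc)
    also have "\<dots> = (\<Sum>i\<in>I. y i * (\<Sum>j\<in>J. M i j * w j))"
      by (subst sum.swap) (simp add: sum_distrib_left)
    finally have "(\<Sum>i\<in>I. y i * (\<Sum>j\<in>J. M i j * w j)) \<le> 0" .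
    moreover have "0 < (\<Sum>i\<in>I. y i * (\<Sum>j\<in>J. M i j * w j))"
      using assms(1) i0(1)
    proof (rule sum_pos2)
      show "0 < y i0 * (\<Sum>j\<in>J. M i0 j * w j)"
        using i0 w(2) by simp
      show "0 \<le> y i * (\<Sum>j\<in>J. M i j * w j)" if "i \<in> I" for i
        using that y w(2)
        by (intro mult_nonneg_nonneg)
          (auto simp: nonzero_weight_function_def weight_function_def less_imp_le)
    qed
    ultimately show False
      by simp
  qed
next
  assume column: "\<forall>y. nonzero_weight_function I y \<longrightarrow> (\<exists>j\<in>J. 0 < (\<Sum>i\<in>I. y i * M i j))"
  define comb where "comb = (\<lambda>y j. \<Sum>i\<in>I. y i * M i j)"
  define K where "K = comb ` {y. nonzero_weight_function I y}"
  have comb_in_K: "comb y \<in> K" if "nonzero_weight_function I y" for y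
    using that by (simp add: K_def)
  have "M i \<in> K" if "i \<in> I" for i
  proof -
    have "comb (\<lambda>k. if k = i then 1 else 0) = M i"
    proof
      fix j
      have "comb (\<lambda>k. if k = i then 1 else 0) j = (\<Sum>k\<in>I. if k = i then M k j else 0)"
        unfolding comb_def by (intro sum.cong) auto
      then show "comb (\<lambda>k. if k = i then 1 else 0) j = M i j"
        using assms(1) that by simp
    qed
    moreover have "nonzero_weight_function I (\<lambda>k. if k = i then 1 else 0)"
      using that by (auto simp: nonzero_weight_function_def weight_function_def)
    ultimately show ?thesis
      using comb_in_K by metis
  qed
  then have "M ` I \<subseteq> K"
    by blast
  moreover have "(\<lambda>j. r j + s j) \<in> K" if "r \<in> K" "s \<in> K" for r s
  proof -
    obtain y z where yz: "nonzero_weight_function I y" "r = comb y"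
        "nonzero_weight_function I z" "s = comb z"
      using \<open>r \<in> K\<close> \<open>s \<in> K\<close> by (auto simp: K_def)
    then have "nonzero_weight_function I (\<lambda>i. y i + z i)"
      by (force simp: nonzero_weight_function_def weight_function_def intro: add_pos_nonneg)
    moreover have "comb (\<lambda>i. y i + z i) = (\<lambda>j. r j + s j)"
      by (simp add: yz comb_def distrib_right sum.distrib)
    ultimately show ?thesis
      using comb_in_K by metis
  qed
  moreover have "(\<lambda>j. c * r j) \<in> K" if c: "0 < c" and "r \<in> K" for c r
  proof -
    obtain y where y: "nonzero_weight_function I y" "r = comb y"
      using \<open>r \<in> K\<close> by (auto simp: K_def)
    then have "nonzero_weight_function I (\<lambda>i. c * y i)"
      using c by (force simp: nonzero_weight_function_def weight_function_def)
    moreover have "comb (\<lambda>i. c * y i) = (\<lambda>j. c * r j)"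
      by (simp add: y comb_def sum_distrib_left mult.assoc)
    ultimately show ?thesis
      using comb_in_K by metis
  qed
  moreover have "\<exists>j\<in>J. 0 < r j" if "r \<in> K" for r
    using that column by (auto simp: K_def comb_def)
  ultimately have "\<exists>w. (\<forall>j\<in>J. 0 \<le> w j) \<and> (\<forall>r\<in>M ` I. 0 < (\<Sum>j\<in>J. r j * w j))"
    using assms by (intro positive_functional_on_finite_subset_of_cone[where K = K]) auto
  then show "\<exists>w. weight_function J w \<and> (\<forall>i\<in>I. 0 < (\<Sum>j\<in>J. M i j * w j))"
    by (auto simp: weight_function_def)
qed

section \<open>Orientations as sign matrices\<close>

lemma finite_separations:
  assumes "finite V" "\<forall>s\<in>S. separation V s"
  shows "finite S"
proof (rule finite_subset)
  show "S \<subseteq> Pow (Pow V)"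
    using assms(2) by (force simp: separation_def)
  show "finite (Pow (Pow V))"
    using assms(1) by simp
qed

lemma orientation_choice:
  assumes "orientation S \<sigma>"
  obtains A B where "\<forall>s\<in>S. {A s, B s} = s" "\<sigma> = (\<lambda>s. (A s, B s)) ` S"
proof -
  have "\<forall>s\<in>S. \<exists>p. p \<in> \<sigma> \<and> p \<in> orientations s"
    using assms unfolding orientation_def by (blast dest: ex1_implies_ex)
  then obtain f where f: "\<And>s. s \<in> S \<Longrightarrow> f s \<in> \<sigma> \<and> f s \<in> orientations s"
    by metis
  have "p \<in> f ` S" if "p \<in> \<sigma>" for p
  proof -
    obtain s where s: "s \<in> S" "p \<in> orientations s"
      using assms \<open>p \<in> \<sigma>\<close> unfolding orientation_def by blast
    then have "\<exists>!p. p \<in> \<sigma> \<and> p \<in> orientations s"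
      using assms by (simp add: orientation_def)
    then have "p = f s"
      using f[OF s(1)] that s(2) by (elim ex1E) metis
    then show ?thesis
      using s(1) by simp
  qed
  then have "\<sigma> = f ` S"
    using f by blast
  moreover have "{fst (f s), snd (f s)} = s" if "s \<in> S" for s
    using f[OF that] by (auto simp: orientations_def)
  ultimately show ?thesis
    by (intro that[of "fst \<circ> f" "snd \<circ> f"]) simp_all
qed

text \<open>
  The assumptions make \<open>s \<mapsto> (A s, B s)\<close> injective with image \<open>\<sigma>\<close>, so the ordered pairs that
  define the dual sides can be traded for elements of \<open>S\<close>. The degenerate \<open>{V}\<close> is included:
  it lies on both dual sides of every \<open>v \<in> V\<close>, hence contributes 0 to the sign matrix.
\<close>

lemma dual_sides_eq:
  assumes AB: "\<forall>s\<in>S. {A s, B s} = s" and \<sigma>: "\<sigma> = (\<lambda>s. (A s, B s)) ` S"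
  shows "C_side S \<sigma> v = {s \<in> S. v \<in> A s}" and "D_side S \<sigma> v = {s \<in> S. v \<in> B s}"
proof -
  have *: "(\<exists>X Y. s = {X, Y} \<and> {X, Y} \<in> S \<and> (X, Y) \<in> \<sigma> \<and> Q X Y) \<longleftrightarrow> s \<in> S \<and> Q (A s) (B s)"
    for s Q
  proof
    assume "\<exists>X Y. s = {X, Y} \<and> {X, Y} \<in> S \<and> (X, Y) \<in> \<sigma> \<and> Q X Y"
    then obtain s' where "s' \<in> S" "s = {A s', B s'}" "Q (A s') (B s')"
      by (auto simp: \<sigma>)
    then show "s \<in> S \<and> Q (A s) (B s)"
      using AB by simp
  next
    assume "s \<in> S \<and> Q (A s) (B s)"
    then show "\<exists>X Y. s = {X, Y} \<and> {X, Y} \<in> S \<and> (X, Y) \<in> \<sigma> \<and> Q X Y"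
      using AB by (intro exI[of _ "A s"] exI[of _ "B s"]) (auto simp: \<sigma>)
  qed
  show "C_side S \<sigma> v = {s \<in> S. v \<in> A s}"
    unfolding C_side_def using *[where Q = "\<lambda>X Y. v \<in> X"] by simp
  show "D_side S \<sigma> v = {s \<in> S. v \<in> B s}"
    unfolding D_side_def using *[where Q = "\<lambda>X Y. v \<in> Y"] by simp
qed

lemma sum_less_iff_sign_sum_pos:
  fixes w :: "'b \<Rightarrow> real"
  assumes "finite Y"
  shows "sum w {y \<in> Y. P y} < sum w {y \<in> Y. Q y} \<longleftrightarrow>
    0 < (\<Sum>y\<in>Y. w y * (of_bool (Q y) - of_bool (P y)))"
proof -
  have indicator_sum: "sum w {y \<in> Y. P y} = (\<Sum>y\<in>Y. w y * of_bool (P y))" for P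
    using assms by (intro sum.mono_neutral_cong_left) auto
  show ?thesis
    by (simp add: indicator_sum[of P] indicator_sum[of Q] right_diff_distrib sum_subtractf)
qed

section \<open>Induced orientations and the dual set of separations\<close>

theorem theorem8:
  fixes V :: "'a set" and S :: "'a set set set" and \<sigma> :: "('a set \<times> 'a set) set"
  assumes "finite V"
    and "\<forall>s\<in>S. separation V s"
    and "orientation S \<sigma>"
  shows "((\<exists>w. weight_function V w \<and> induces_orientation w \<sigma>) \<longleftrightarrow>
          (\<forall>w'. nonzero_weight_function S w' \<longrightarrow>
             (\<exists>v\<in>V. sum w' (C_side S \<sigma> v) < sum w' (D_side S \<sigma> v)))) \<and>
         (inj_on (dual_separation S \<sigma>) V \<longrightarrow>
          ((\<exists>w. weight_function V w \<and> induces_orientation w \<sigma>) \<longleftrightarrow>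
           (\<forall>w'. nonzero_weight_function S w' \<longrightarrow>
              (\<exists>p\<in>default_orientation V S \<sigma>. induces w' p))))"
proof -
  have "finite S"
    using assms(1,2) by (rule finite_separations)
  obtain A B where AB: "\<forall>s\<in>S. {A s, B s} = s" and \<sigma>: "\<sigma> = (\<lambda>s. (A s, B s)) ` S"
    by (rule orientation_choice[OF assms(3)])
  define M :: "'a set set \<Rightarrow> 'a \<Rightarrow> real"
    where "M = (\<lambda>s v. of_bool (v \<in> B s) - of_bool (v \<in> A s))"
  have row: "induces w (A s, B s) \<longleftrightarrow> 0 < (\<Sum>v\<in>V. M s v * w v)" if "s \<in> S" for w s
  proof -
    have "separation V {A s, B s}"
      using assms(2) that bspec[OF AB that] by simp
    then have "A s \<subseteq> V" "B s \<subseteq> V"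
      by (auto simp: separation_def doubleton_eq_iff)
    then have "{v \<in> V. v \<in> A s} = A s" "{v \<in> V. v \<in> B s} = B s"
      by blast+
    then show ?thesis
      using sum_less_iff_sign_sum_pos[OF assms(1), of w "\<lambda>v. v \<in> A s" "\<lambda>v. v \<in> B s"]
      by (simp add: induces_def M_def mult.commute)
  qed
  have sides: "C_side S \<sigma> v = {s \<in> S. v \<in> A s}" "D_side S \<sigma> v = {s \<in> S. v \<in> B s}" for v
    by (rule dual_sides_eq[OF AB \<sigma>])+
  have column: "sum w' (C_side S \<sigma> v) < sum w' (D_side S \<sigma> v) \<longleftrightarrow> 0 < (\<Sum>s\<in>S. w' s * M s v)"
    for w' v
    using sum_less_iff_sign_sum_pos[OF \<open>finite S\<close>]
    by (simp add: sides M_def)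
  have "(\<exists>w. weight_function V w \<and> induces_orientation w \<sigma>) \<longleftrightarrow>
      (\<exists>w. weight_function V w \<and> (\<forall>s\<in>S. 0 < (\<Sum>v\<in>V. M s v * w v)))"
    using row by (simp add: induces_orientation_def \<sigma>)
  also have "\<dots> \<longleftrightarrow> (\<forall>w'. nonzero_weight_function S w' \<longrightarrow>
      (\<exists>v\<in>V. sum w' (C_side S \<sigma> v) < sum w' (D_side S \<sigma> v)))"
    using Ville_alternative[OF \<open>finite S\<close> assms(1)] by (simp add: column)
  finally have equiv: "(\<exists>w. weight_function V w \<and> induces_orientation w \<sigma>) \<longleftrightarrow>
      (\<forall>w'. nonzero_weight_function S w' \<longrightarrow>
        (\<exists>v\<in>V. sum w' (C_side S \<sigma> v) < sum w' (D_side S \<sigma> v)))" .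
  have "(\<exists>p\<in>default_orientation V S \<sigma>. induces w' p) \<longleftrightarrow>
      (\<exists>v\<in>V. sum w' (C_side S \<sigma> v) < sum w' (D_side S \<sigma> v))" for w'
    by (auto simp: default_orientation_def induces_def)
  with equiv show ?thesis
    by simp
qed

end
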